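(* There exists an absolute constant $c>0$ such that for any (not necessarily product) probability measure $\mu$ on $\{0,1\}^{\mathbb N}$ with $T(\mu)<\infty$ and every integer $n\ge \mathrm e^3$, $$\Delta_n(\mu)\le c\left(\sqrt{\frac{S(\mu)}{n}}+\frac{T(\mu)\log n}{n}\right).$$
   Context: $\mathbb N=\{1,2,3,\dots\}$; $\log$ is the natural logarithm and $\mathrm e$ its base. $\{0,1\}^{\mathbb N}$ carries the $\sigma$-algebra generated by finite-dimensional cylinders. For a probability measure $\mu$ on $\{0,1\}^{\mathbb N}$, let $p=\mathbb E_{X\sim\mu}[X]\in[0,1]^{\mathbb N}$ be its mean, i.e. $p(j)=\mathbb E[X(j)]$. Given $n$ i.i.d. draws $X_1,\dots,X_n\sim\mu$, let $\hat p_n(j)=\frac1n\sum_{i=1}^nX_i(j)$ and $\Delta_n(\mu)=\mathbb E\sup_{j\in\mathbb N}|\hat p_n(j)-p(j)|$. For a non-increasing sequence $q:\mathbb N\to[0,\frac12]$ with $q(j)\to0$, $$S(q)=\sup_{j\in\mathbb N}q(j)\log(j+1),\qquad T(q)=\sup_{j\in\mathbb N}\frac{\log(j+1)}{\log(1/q(j))},$$ where a term of $T$ with $q(j)=0$ is interpreted as $0$. For $\mu$ with mean $p$, put $\tilde p(j)=\min\{p(j),1-p(j)\}$. If $\tilde p(j)\to0$, let $\tilde p^{\downarrow}$ be its non-increasing rearrangement ($\tilde p^{\downarrow}(j)$ is the $j$-th largest entry of $\tilde p$, counted with multiplicity) and set $S(\mu)=S(\tilde p^{\downarrow})$, $T(\mu)=T(\tilde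 p^{\downarrow})$; otherwise set $S(\mu)=T(\mu)=\infty$. *)

theory Defs
  imports "HOL-Probability.Probability"
begin

text \<open>The index set is \<open>{1..} :: nat set\<close> throughout, so values of sequences at \<open>0\<close> never matter.\<close>

definition binary_sequences :: "(nat \<Rightarrow> real) measure" where
  "binary_sequences = (\<Pi>\<^sub>M j\<in>{1..}. count_space {0, 1})"

definition mean :: "(nat \<Rightarrow> real) measure \<Rightarrow> nat \<Rightarrow> real" where
  "mean \<mu> j = (\<integral>X. X j \<partial>\<mu>)"

text \<open>A sample \<open>X\<close> consists of the draws \<open>X 1, \<dots>, X n\<close>, each of them a binary sequence.\<close>

definition empirical_mean :: "nat \<Rightarrow> (nat \<Rightarrow> nat \<Rightarrow> real) \<Rightarrow> nat \<Rightarrow> real" where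
  "empirical_mean n X j = (\<Sum>i=1..n. X i j) / real n"

definition Delta :: "nat \<Rightarrow> (nat \<Rightarrow> real) measure \<Rightarrow> real" where
  "Delta n \<mu> =
     (\<integral>X. (SUP j\<in>{1..}. \<bar>empirical_mean n X j - mean \<mu> j\<bar>) \<partial>(\<Pi>\<^sub>M i\<in>{1..n}. \<mu>))"

definition S_seq :: "(nat \<Rightarrow> real) \<Rightarrow> ereal" where
  "S_seq q = (SUP j\<in>{1..}. ereal (q j * ln (real j + 1)))"

definition T_seq :: "(nat \<Rightarrow> real) \<Rightarrow> ereal" where
  "T_seq q = (SUP j\<in>{1..}. ereal (if q j = 0 then 0 else ln (real j + 1) / ln (1 / q j)))"

text \<open>
  \<open>v\<close> is the \<open>j\<close>-th largest entry of \<open>f\<close>, counted with multiplicity: it is an entry, fewer than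
  \<open>j\<close> indices carry a larger entry, and at least \<open>j\<close> indices carry an entry \<open>\<ge> v\<close>. A sequence
  with infinitely many positive entries may also have zeros, which do not occur in its
  non-increasing rearrangement; so the rearrangement need not be a permutation of the sequence.
\<close>

definition is_nth_largest :: "(nat \<Rightarrow> real) \<Rightarrow> nat \<Rightarrow> real \<Rightarrow> bool" where
  "is_nth_largest f j v \<longleftrightarrow>
     v \<in> f ` {1..} \<and>
     finite {i \<in> {1..}. f i > v} \<and> card {i \<in> {1..}. f i > v} < j \<and>
     (infinite {i \<in> {1..}. f i \<ge> v} \<or> j \<le> card {i \<in> {1..}. f i \<ge> v})"

definition rearrangement :: "(nat \<Rightarrow> real) \<Rightarrow> nat \<Rightarrow> real" where
  "rearrangement f j = (THE v. is_nth_largest f j v)"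

lemma is_nth_largest_unique:
  assumes "is_nth_largest f j v" "is_nth_largest f j w"
  shows "v = w"
proof -
  have *: False if "is_nth_largest f j v" "is_nth_largest f j w" "v < w" for v w
  proof -
    have sub: "{i \<in> {1..}. f i \<ge> w} \<subseteq> {i \<in> {1..}. f i > v}"
      using \<open>v < w\<close> by auto
    have fin: "finite {i \<in> {1..}. f i > v}" and less: "card {i \<in> {1..}. f i > v} < j"
      using that(1) unfolding is_nth_largest_def by blast+
    have "j \<le> card {i \<in> {1..}. f i \<ge> w}"
      using that(2) finite_subset[OF sub fin] unfolding is_nth_largest_def by blast
    then show False
      using card_mono[OF fin sub] less by linarith
  qed
  show ?thesis
    using *[of v w] *[of w v] assms by (meson linorder_neqE)
qed

lemma is_nth_largest_exists:
  assumes nonneg: "\<And>i. i \<ge> 1 \<Longrightarrow> f i \<ge> 0" and lim: "f \<longlonglongrightarrow> 0" and "j \<ge> 1"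
  shows "\<exists>v. is_nth_largest f j v"
proof -
  have fin: "finite {i \<in> {1..}. f i \<ge> t}" if "t > 0" for t
  proof -
    have "eventually (\<lambda>i. f i < t) sequentially"
      using order_tendstoD(2)[OF lim that] .
    then obtain N where "\<And>i. i \<ge> N \<Longrightarrow> f i < t"
      by (auto simp: eventually_sequentially)
    then have "{i \<in> {1..}. f i \<ge> t} \<subseteq> {..<N}"
      by (force simp: not_le[symmetric])
    then show ?thesis
      using finite_subset by blast
  qed
  define P where "P = {i \<in> {1..}. f i > 0}"
  show ?thesis
  proof (cases "finite P \<and> card P < j")
    case True
    have inf: "infinite ({1..} - P)"
      using True by (simp add: infinite_Ici)
    then obtain k where k: "k \<in> {1..} - P"
      by (metis all_not_in_conv finite.emptyI)
    have "f k = 0"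
      using k nonneg[of k] by (auto simp: P_def)
    moreover have "infinite {i \<in> {1..}. f i \<ge> 0}"
      using inf nonneg by (metis (no_types, lifting) DiffD1 atLeast_iff finite_subset mem_Collect_eq subsetI)
    ultimately have "is_nth_largest f j 0"
      using True k unfolding is_nth_largest_def P_def by force
    then show ?thesis ..
  next
    case False
    then obtain A where A: "A \<subseteq> P" "finite A" "card A = j"
      by (metis infinite_arbitrarily_large not_le obtain_subset_with_card_n)
    define G where "G v = {i \<in> {1..}. f i \<ge> v}" for v
    define m where "m = Min (f ` A)"
    have "A \<noteq> {}"
      using A(3) \<open>j \<ge> 1\<close> by auto
    then have m: "m > 0" "\<And>i. i \<in> A \<Longrightarrow> m \<le> f i" "m \<in> f ` A"
      using A unfolding m_def P_def by (auto intro: Min_in)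
    define V where "V = {v \<in> f ` G m. j \<le> card (G v)}"
    have finG: "finite (G m)"
      using fin[OF m(1)] by (simp add: G_def)
    have "A \<subseteq> G m"
      using A(1) m(2) by (auto simp: G_def P_def)
    then have "j \<le> card (G m)"
      using card_mono[OF finG] A(3) by blast
    moreover have "m \<in> f ` G m"
      using m(3) \<open>A \<subseteq> G m\<close> by blast
    ultimately have "m \<in> V"
      by (simp add: V_def)
    have "finite V"
      using finG by (simp add: V_def)
    define v where "v = Max V"
    have v: "v \<in> V" and v_max: "\<And>w. w \<in> V \<Longrightarrow> w \<le> v"
      using Max_in[OF \<open>finite V\<close>] \<open>m \<in> V\<close> Max_ge[OF \<open>finite V\<close>]
      unfolding v_def by blast+
    have "m \<le> v"
      using v_max \<open>m \<in> V\<close> .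
    define L where "L = {i \<in> {1..}. f i > v}"
    have "L \<subseteq> G m"
      using \<open>m \<le> v\<close> by (auto simp: L_def G_def)
    then have finL: "finite L"
      using finG finite_subset by blast
    have "card L < j"
    proof (rule ccontr)
      assume "\<not> card L < j"
      then have "L \<noteq> {}"
        using \<open>j \<ge> 1\<close> by auto
      define w where "w = Min (f ` L)"
      have w: "w \<in> f ` L" "\<And>i. i \<in> L \<Longrightarrow> w \<le> f i"
        using finL \<open>L \<noteq> {}\<close> Min_in[of "f ` L"] by (auto simp: w_def)
      have "w > v"
        using w(1) by (auto simp: L_def)
      have "finite (G w)"
        using fin[of w] \<open>w > v\<close> \<open>m \<le> v\<close> m(1) by (simp add: G_def)
      moreover have "L \<subseteq> G w"
        using w(2) by (auto simp: G_def L_def)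
      ultimately have "j \<le> card (G w)"
        using card_mono \<open>\<not> card L < j\<close> by (metis le_trans not_less)
      moreover have "w \<in> f ` G m"
        using w(1) \<open>L \<subseteq> G m\<close> by blast
      ultimately have "w \<in> V"
        by (simp add: V_def)
      then show False
        using v_max[of w] \<open>w > v\<close> by simp
    qed
    moreover have "v \<in> f ` {1..}" "j \<le> card (G v)"
      using v by (auto simp: V_def G_def)
    ultimately have "is_nth_largest f j v"
      using finL unfolding is_nth_largest_def L_def G_def by blast
    then show ?thesis ..
  qed
qed

lemma is_nth_largest_rearrangement:
  assumes "\<And>i. i \<ge> 1 \<Longrightarrow> f i \<ge> 0" "f \<longlonglongrightarrow> 0" "j \<ge> 1"
  shows "is_nth_largest f j (rearrangement f j)"
  unfolding rearrangement_def
  using theI'[of "is_nth_largest f j"] is_nth_largest_exists[of f j, OF assms] is_nth_largest_unique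
  by blast

definition tilde_mean :: "(nat \<Rightarrow> real) measure \<Rightarrow> nat \<Rightarrow> real" where
  "tilde_mean \<mu> j = min (mean \<mu> j) (1 - mean \<mu> j)"

definition S_measure :: "(nat \<Rightarrow> real) measure \<Rightarrow> ereal" where
  "S_measure \<mu> =
     (if tilde_mean \<mu> \<longlonglongrightarrow> 0 then S_seq (rearrangement (tilde_mean \<mu>)) else \<infinity>)"

definition T_measure :: "(nat \<Rightarrow> real) measure \<Rightarrow> ereal" where
  "T_measure \<mu> =
     (if tilde_mean \<mu> \<longlonglongrightarrow> 0 then T_seq (rearrangement (tilde_mean \<mu>)) else \<infinity>)"

definition ereal_sqrt :: "ereal \<Rightarrow> ereal" where
  "ereal_sqrt x = (if x = \<infinity> then \<infinity> else ereal (sqrt (real_of_ereal x)))"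

end

theory Submission
  imports Defs
begin

text \<open>For a threshold \<open>e\<close>, the supremum of the deviations \<open>d j\<close> of the empirical mean is at most \<open>e\<close>
  plus the sum over \<open>j\<close> of the excesses \<open>max 0 (\<bar>d j\<bar> - e)\<close>, whatever the dependence between
  the coordinates. A Chernoff bound with a parameter that depends on \<open>j\<close> controls the expected excess.
  For \<open>e = 12 (sqrt (S / n) + T ln n / n)\<close> the bound is summable along the non-increasing
  rearrangement: where \<open>q \<ge> e\<close> this is due to \<open>S\<close>, and where \<open>q < e\<close> it is due to \<open>T\<close>,
  provided that \<open>T\<close> is not so small that \<open>e\<close> falls below \<open>1 / n\<close>. If \<open>4 T ln n < 1\<close>, then
  \<open>q \<le> (j + 1) powr (- 1 / T)\<close> is so small that already the sum of the first moments
  \<open>E \<bar>d j\<bar> \<le> 2 q\<close> suffices.\<close>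

section \<open>Elementary inequalities for \<open>ln\<close>, \<open>exp\<close> and sums\<close>

text \<open>The difference of the two sides vanishes at \<open>0\<close> and has derivative
  \<open>x^2 / ((1 + x) * (2 + x)^2)\<close>.\<close>

lemma ln_one_plus_ge:
  fixes u :: real
  assumes "0 \<le> u"
  shows "2 * u / (2 + u) \<le> ln (1 + u)"
proof -
  have "ln (1 + 0) - 2 * 0 / (2 + 0) \<le> ln (1 + u) - 2 * u / (2 + u)"
  proof (rule DERIV_nonneg_imp_nondecreasing[OF assms], intro exI conjI)
    fix x :: real
    assume x: "0 \<le> x"
    show "((\<lambda>x. ln (1 + x) - 2 * x / (2 + x)) has_real_derivative
        (1 / (1 + x) - (2 * (2 + x) - 2 * x) / (2 + x)\<^sup>2)) (at x)"
      using x by (auto intro!: derivative_eq_intros simp: power2_eq_square)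
    have "(1 + x) * 4 \<le> (2 + x)\<^sup>2"
      by (simp add: power2_eq_square algebra_simps)
    then show "0 \<le> 1 / (1 + x) - (2 * (2 + x) - 2 * x) / (2 + x)\<^sup>2"
      using x by (simp add: field_simps)
  qed
  then show ?thesis by simp
qed

text \<open>For negative \<open>x\<close> the claim is \<open>y \<le> sinh y\<close> at
  \<open>y = - x\<close>.\<close>

lemma exp_minus_linear_le_abs:
  fixes x :: real
  shows "exp x - 1 - x \<le> exp \<bar>x\<bar> - 1 - \<bar>x\<bar>"
proof (cases "0 \<le> x")
  case False
  then show ?thesis
    using real_le_x_sinh[of "- x"] by (simp add: exp_minus field_simps)
qed simp

text \<open>The left side is the moment generating function of a centred Bernoulli variable. It is
  unchanged when \<open>p\<close> and \<open>l\<close> become \<open>1 - p\<close> and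
  \<open>- l\<close>, so the bound that follows from \<open>1 + x \<le> exp x\<close> holds for the
  smaller of \<open>p\<close> and \<open>1 - p\<close>. With \<open>\<bar>l\<bar>\<close> on the
  right it serves both tails.\<close>

lemma bernoulli_mgf_le:
  fixes p l :: real
  assumes "0 \<le> p" "p \<le> 1"
  shows "exp (- (l * p)) * (1 + p * (exp l - 1)) \<le> exp (min p (1 - p) * (exp \<bar>l\<bar> - 1 - \<bar>l\<bar>))"
proof -
  have *: "exp (- (l * q)) * (1 + q * (exp l - 1)) \<le> exp (q * (exp \<bar>l\<bar> - 1 - \<bar>l\<bar>))"
    if "0 \<le> q" for q l :: real
  proof -
    have "exp (- (l * q)) * (1 + q * (exp l - 1)) \<le> exp (- (l * q)) * exp (q * (exp l - 1))"
      using exp_ge_add_one_self[of "q * (exp l - 1)"] by (intro mult_left_mono) auto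
    also have "\<dots> = exp (q * (exp l - 1 - l))"
      by (simp add: exp_add[symmetric] algebra_simps)
    also have "\<dots> \<le> exp (q * (exp \<bar>l\<bar> - 1 - \<bar>l\<bar>))"
      using mult_left_mono[OF exp_minus_linear_le_abs that] by simp
    finally show ?thesis .
  qed
  show ?thesis
  proof (cases "p \<le> 1 - p")
    case True
    then show ?thesis using *[OF assms(1), of l] by (simp add: min_def)
  next
    case False
    have "exp (- (l * p)) * (1 + p * (exp l - 1))
        = exp (- (- l * (1 - p))) * (1 + (1 - p) * (exp (- l) - 1))"
    proof -
      have "exp (- (- l * (1 - p))) = exp (- (l * p)) * exp l"
        by (simp add: exp_add[symmetric] algebra_simps)
      moreover have "exp l * (1 + (1 - p) * (exp (- l) - 1)) = 1 + p * (exp l - 1)"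
        by (simp add: algebra_simps exp_minus)
      ultimately show ?thesis
        by (simp add: mult.assoc)
    qed
    then show ?thesis
      using False *[of "1 - p" "- l"] assms by (simp add: min_def)
  qed
qed

text \<open>Apply \<open>x \<le> exp x\<close> at \<open>x = l * (\<bar>d\<bar> - e)\<close>, then
  bound \<open>exp \<bar>y\<bar>\<close> by \<open>exp y + exp (- y)\<close>, so that the tails can
  be integrated separately.\<close>

lemma abs_excess_le_exp:
  fixes d e l :: real
  assumes "0 < l"
  shows "max 0 (\<bar>d\<bar> - e) \<le> (exp (l * d) + exp (- (l * d))) * (exp (- (l * e)) / l)"
proof -
  have "l * max 0 (\<bar>d\<bar> - e) \<le> exp (l * (\<bar>d\<bar> - e))"
    using exp_ge_add_one_self[of "l * (\<bar>d\<bar> - e)"]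
    by (cases "0 \<le> \<bar>d\<bar> - e") (simp_all add: max_def del: exp_ge_add_one_self)
  also have "\<dots> = exp \<bar>l * d\<bar> * exp (- (l * e))"
    using assms by (simp add: exp_add[symmetric] abs_mult algebra_simps)
  also have "\<dots> \<le> (exp (l * d) + exp (- (l * d))) * exp (- (l * e))"
    by (intro mult_right_mono) (auto simp: abs_if)
  finally show ?thesis
    using assms by (simp only: times_divide_eq_right pos_le_divide_eq mult.commute[of l])
qed

text \<open>Telescoping: each term is at most \<open>1 / m - 1 / (m + 1)\<close>. The set
  \<open>A\<close> will consist of positions, which start at \<open>1\<close>.\<close>

lemma sum_inverse_squares_le_1:
  assumes "finite A" "0 \<notin> A"
  shows "(\<Sum>m\<in>A. 1 / (real m + 1)\<^sup>2) \<le> 1"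
proof -
  have *: "(\<Sum>m\<in>{1..k}. 1 / (real m + 1)\<^sup>2) \<le> 1 - 1 / (real k + 1)" for k
  proof (induction k)
    case (Suc k)
    have "1 / (real k + 2)\<^sup>2 \<le> 1 / (real k + 1) - 1 / (real k + 2)"
      using frac_le[of 1 1 "(real k + 1) * (real k + 2)" "(real k + 2)\<^sup>2"]
      by (simp add: power2_eq_square diff_frac_eq mult_mono)
    then show ?case
      using Suc by (simp add: algebra_simps)
  qed simp
  have "A \<subseteq> {1..Max A}"
    using assms by (auto simp: Suc_le_eq intro: gr0I)
  then have "(\<Sum>m\<in>A. 1 / (real m + 1)\<^sup>2) \<le> (\<Sum>m\<in>{1..Max A}. 1 / (real m + 1)\<^sup>2)"
    by (intro sum_mono2) auto
  also have "\<dots> \<le> 1"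
    using *[of "Max A"] by (smt (verit) divide_nonneg_nonneg of_nat_0_le_iff)
  finally show ?thesis .
qed

section \<open>Positions in the non-increasing rearrangement\<close>

text \<open>Ties are broken by the index, so that distinct indices get distinct positions.\<close>

definition position :: "(nat \<Rightarrow> real) \<Rightarrow> nat \<Rightarrow> nat" where
  "position f i = card {k \<in> {1..}. f i < f k \<or> f k = f i \<and> k \<le> i}"

context
  fixes f :: "nat \<Rightarrow> real"
  assumes lim: "f \<longlonglongrightarrow> 0"
begin

lemma finite_ge_pos:
  assumes "0 < t"
  shows "finite {k \<in> {1..}. t \<le> f k}"
proof -
  obtain N where "\<And>i. i \<ge> N \<Longrightarrow> f i < t"
    using order_tendstoD(2)[OF lim assms] by (auto simp: eventually_sequentially)
  then have "{k \<in> {1..}. t \<le> f k} \<subseteq> {..<N}"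
    by (force simp: not_le[symmetric])
  then show ?thesis
    using finite_subset by blast
qed

lemma finite_position_set:
  assumes "0 < f i"
  shows "finite {k \<in> {1..}. f i < f k \<or> f k = f i \<and> k \<le> i}"
  by (rule finite_subset[OF _ finite_ge_pos[OF assms]]) auto

lemma position_strict_mono:
  assumes "1 \<le> i" "0 < f i" "f i < f k \<or> f i = f k \<and> k < i"
  shows "position f k < position f i"
  unfolding position_def
proof (rule psubset_card_mono[OF finite_position_set[OF assms(2)]], rule psubsetI)
  let ?A = "\<lambda>i. {k \<in> {1..}. f i < f k \<or> f k = f i \<and> k \<le> i}"
  show "?A k \<subseteq> ?A i"
    using assms(3) by auto
  have "i \<in> ?A i" "i \<notin> ?A k"
    using assms by auto
  then show "?A k \<noteq> ?A i"
    by blast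
qed

text \<open>The indices with larger entries form a proper subset of those counted by
  \<open>position f i\<close>, because \<open>i\<close> counts itself. Positivity of
  \<open>f i\<close> keeps these sets finite; for a zero entry the counted set can be infinite and
  its \<open>card\<close> then says nothing.\<close>

lemma rearrangement_position:
  assumes "1 \<le> i" "0 < f i"
  shows "rearrangement f (position f i) = f i"
proof -
  have "is_nth_largest f (position f i) (f i)"
    unfolding is_nth_largest_def
  proof (intro conjI disjI2)
    show "f i \<in> f ` {1..}" using assms by simp
    show "finite {k \<in> {1..}. f i < f k}"
      by (rule finite_subset[OF _ finite_position_set[OF assms(2)]]) auto
    show "card {k \<in> {1..}. f i < f k} < position f i"
      unfolding position_def
    proof (rule psubset_card_mono[OF finite_position_set[OF assms(2)]])
      show "{k \<in> {1..}. f i < f k} \<subset> {k \<in> {1..}. f i < f k \<or> f k = f i \<and> k \<le> i}"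
        using assms by auto
    qed
    show "position f i \<le> card {k \<in> {1..}. f i \<le> f k}"
      unfolding position_def by (rule card_mono[OF finite_ge_pos[OF assms(2)]]) auto
  qed
  then show ?thesis
    unfolding rearrangement_def using is_nth_largest_unique by blast
qed

text \<open>Ordering by value, then by index, is total, so one of two distinct indices comes
  strictly first.\<close>

lemma inj_on_position: "inj_on (position f) {i \<in> {1..}. 0 < f i}"
proof (rule inj_onI)
  fix i k
  assume "i \<in> {i \<in> {1..}. 0 < f i}" "k \<in> {i \<in> {1..}. 0 < f i}" "position f i = position f k"
  then show "i = k"
    using position_strict_mono[of i k] position_strict_mono[of k i]
    by (cases "f i" "f k" rule: linorder_cases; cases i k rule: linorder_cases) auto
qed

lemma position_pos:
  assumes "1 \<le> i" "0 < f i"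
  shows "0 < position f i"
  unfolding position_def card_gt_0_iff using assms finite_position_set[OF assms(2)] by auto

end

section \<open>Moments of a single coordinate\<close>

locale sampling =
  fixes \<mu> :: "(nat \<Rightarrow> real) measure"
  assumes prob: "prob_space \<mu>" and sets_eq: "sets \<mu> = sets binary_sequences"
begin

sublocale prob_space \<mu> by (rule prob)

lemma coordinate_measurable [measurable]: "1 \<le> j \<Longrightarrow> (\<lambda>X. X j) \<in> borel_measurable \<mu>"
proof -
  assume "1 \<le> j"
  then have "(\<lambda>X. X j) \<in> binary_sequences \<rightarrow>\<^sub>M count_space {0, 1}"
    unfolding binary_sequences_def by (intro measurable_component_singleton) auto
  then have "(\<lambda>X. X j) \<in> \<mu> \<rightarrow>\<^sub>M count_space {0, 1}"
    using measurable_cong_sets[OF sets_eq refl] by blast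
  then show ?thesis
    by (rule measurable_compose) simp
qed

lemma coordinate_binary: "X \<in> space \<mu> \<Longrightarrow> 1 \<le> j \<Longrightarrow> X j = 0 \<or> X j = 1"
  using sets_eq_imp_space_eq[OF sets_eq]
  by (auto simp: binary_sequences_def space_PiM PiE_iff)

lemma coordinate_integrable: "1 \<le> j \<Longrightarrow> integrable \<mu> (\<lambda>X. X j)"
  by (rule integrable_const_bound[where B = 1]) (use coordinate_binary in force)+

text \<open>Every function on \<open>{0, 1}\<close> is affine, so its integral depends only on the
  mean. The values \<open>a\<close> at \<open>0\<close> and \<open>a + b\<close> at \<open>1\<close>
  must be nonnegative for \<open>ennreal\<close> not to truncate them.\<close>

lemma nn_integral_affine:
  assumes "1 \<le> j" "0 \<le> a" "0 \<le> a + b"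
    and "\<And>x. x = 0 \<or> x = 1 \<Longrightarrow> g x = a + b * x"
  shows "(\<integral>\<^sup>+X. ennreal (g (X j)) \<partial>\<mu>) = ennreal (a + b * mean \<mu> j)"
proof -
  have "(\<integral>\<^sup>+X. ennreal (g (X j)) \<partial>\<mu>) = (\<integral>\<^sup>+X. ennreal (a + b * X j) \<partial>\<mu>)"
    using assms(4) coordinate_binary[OF _ assms(1)] by (intro nn_integral_cong) (metis)
  also have "\<dots> = ennreal (\<integral>X. a + b * X j \<partial>\<mu>)"
    using assms coordinate_binary[OF _ assms(1)] coordinate_integrable[OF assms(1)]
    by (intro nn_integral_eq_integral) (force intro!: AE_I2)+
  also have "(\<integral>X. a + b * X j \<partial>\<mu>) = a + b * mean \<mu> j"
    using coordinate_integrable[OF assms(1)] by (simp add: mean_def prob_space)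
  finally show ?thesis .
qed

lemma mean_bounds:
  assumes "1 \<le> j"
  shows "0 \<le> mean \<mu> j" "mean \<mu> j \<le> 1"
proof -
  show "0 \<le> mean \<mu> j" unfolding mean_def
    using coordinate_binary[OF _ assms] by (intro integral_nonneg_AE AE_I2) force
  show "mean \<mu> j \<le> 1" unfolding mean_def
    using coordinate_binary[OF _ assms] coordinate_integrable[OF assms]
    by (intro integral_le_const AE_I2) force+
qed

lemma tilde_mean_bounds:
  assumes "1 \<le> j"
  shows "0 \<le> tilde_mean \<mu> j" "tilde_mean \<mu> j \<le> 1 / 2"
  using mean_bounds[OF assms] by (auto simp: tilde_mean_def min_def)

lemma mgf_coordinate_le:
  assumes "1 \<le> j"
  shows "(\<integral>\<^sup>+X. ennreal (exp (l * (X j - mean \<mu> j))) \<partial>\<mu>)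
    \<le> ennreal (exp (tilde_mean \<mu> j * (exp \<bar>l\<bar> - 1 - \<bar>l\<bar>)))"
proof -
  let ?p = "mean \<mu> j"
  have "(\<integral>\<^sup>+X. ennreal (exp (l * (X j - ?p))) \<partial>\<mu>)
      = ennreal (exp (- (l * ?p)) + exp (- (l * ?p)) * (exp l - 1) * ?p)"
    by (rule nn_integral_affine[OF assms, where g = "\<lambda>x. exp (l * (x - ?p))"])
      (auto simp: algebra_simps exp_add[symmetric])
  then show ?thesis
    using bernoulli_mgf_le[OF mean_bounds[OF assms], of l]
    by (simp add: tilde_mean_def algebra_simps ennreal_leI)
qed

text \<open>The first absolute central moment of a Bernoulli variable is
  \<open>2 * p * (1 - p)\<close>.\<close>

lemma abs_deviation_coordinate_le:
  assumes "1 \<le> j"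
  shows "(\<integral>\<^sup>+X. ennreal \<bar>X j - mean \<mu> j\<bar> \<partial>\<mu>) \<le> ennreal (2 * tilde_mean \<mu> j)"
proof -
  let ?p = "mean \<mu> j"
  have p: "0 \<le> ?p" "?p \<le> 1" using mean_bounds[OF assms] .
  have "(\<integral>\<^sup>+X. ennreal \<bar>X j - ?p\<bar> \<partial>\<mu>) = ennreal (?p + (1 - 2 * ?p) * ?p)"
    using p by (intro nn_integral_affine[OF assms, where g = "\<lambda>x. \<bar>x - ?p\<bar>"]) auto
  also have "\<dots> \<le> ennreal (2 * tilde_mean \<mu> j)"
    using p zero_le_square[of "1 - ?p"] zero_le_square[of "?p"]
    by (intro ennreal_leI) (auto simp: tilde_mean_def min_def algebra_simps)
  finally show ?thesis .
qed

section \<open>Deviation of the empirical mean at one coordinate\<close>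

abbreviation sample :: "nat \<Rightarrow> (nat \<Rightarrow> nat \<Rightarrow> real) measure" where
  "sample n \<equiv> \<Pi>\<^sub>M i\<in>{1..n}. \<mu>"

abbreviation deviation :: "nat \<Rightarrow> (nat \<Rightarrow> nat \<Rightarrow> real) \<Rightarrow> nat \<Rightarrow> real" where
  "deviation n X j \<equiv> empirical_mean n X j - mean \<mu> j"

lemma prob_space_sample: "prob_space (sample n)"
  by (intro prob_space_PiM prob)

lemma draw_measurable [measurable]:
  "1 \<le> j \<Longrightarrow> i \<in> {1..n} \<Longrightarrow> (\<lambda>X. X i j) \<in> borel_measurable (sample n)"
  by (rule measurable_compose[OF measurable_component_singleton[of i "{1..n}" "\<lambda>_. \<mu>"] coordinate_measurable])

lemma deviation_measurable [measurable]:
  "1 \<le> j \<Longrightarrow> (\<lambda>X. deviation n X j) \<in> borel_measurable (sample n)"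
  unfolding empirical_mean_def by measurable

lemma deviation_eq: "1 \<le> n \<Longrightarrow> real n * deviation n X j = (\<Sum>i=1..n. X i j - mean \<mu> j)"
  by (simp add: empirical_mean_def sum_subtractf algebra_simps)

text \<open>At a fixed coordinate the exponential of the sum is a product over the draws, whose
  integral factorises over the product measure. Only the draws have to be independent, not the
  coordinates.\<close>

lemma mgf_deviation_le:
  assumes "1 \<le> j" "1 \<le> n"
  shows "(\<integral>\<^sup>+X. ennreal (exp (l * (real n * deviation n X j))) \<partial>sample n)
    \<le> ennreal (exp (real n * (tilde_mean \<mu> j * (exp \<bar>l\<bar> - 1 - \<bar>l\<bar>))))"
proof -
  interpret P: product_sigma_finite "\<lambda>_. \<mu>"
    by unfold_locales
  have "(\<integral>\<^sup>+X. ennreal (exp (l * (real n * deviation n X j))) \<partial>sample n)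
      = (\<integral>\<^sup>+X. (\<Prod>i\<in>{1..n}. ennreal (exp (l * (X i j - mean \<mu> j)))) \<partial>sample n)"
    unfolding deviation_eq[OF assms(2)] sum_distrib_left
    by (simp add: exp_sum prod_ennreal)
  also have "\<dots> = (\<Prod>i\<in>{1..n}. \<integral>\<^sup>+X. ennreal (exp (l * (X j - mean \<mu> j))) \<partial>\<mu>)"
    using assms
    by (intro P.product_nn_integral_prod[where f = "\<lambda>i X. ennreal (exp (l * (X j - mean \<mu> j)))"]) auto
  also have "\<dots> \<le> (\<Prod>i\<in>{1..n}. ennreal (exp (tilde_mean \<mu> j * (exp \<bar>l\<bar> - 1 - \<bar>l\<bar>))))"
    using mgf_coordinate_le[OF assms(1)] by (intro prod_mono_ennreal)
  also have "\<dots> = ennreal (exp (real n * (tilde_mean \<mu> j * (exp \<bar>l\<bar> - 1 - \<bar>l\<bar>))))"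
    by (simp add: ennreal_power exp_of_nat_mult)
  finally show ?thesis .
qed

text \<open>Triangle inequality, and each draw has distribution \<open>\<mu>\<close>. Averaging
  gains nothing here, but the bound is linear in \<open>tilde_mean\<close>, which is what very small
  means call for.\<close>

lemma abs_deviation_le:
  assumes "1 \<le> j" "1 \<le> n"
  shows "(\<integral>\<^sup>+X. ennreal \<bar>deviation n X j\<bar> \<partial>sample n) \<le> ennreal (2 * tilde_mean \<mu> j)"
proof -
  have *: "(\<integral>\<^sup>+X. ennreal \<bar>X i j - mean \<mu> j\<bar> \<partial>sample n) \<le> ennreal (2 * tilde_mean \<mu> j)"
    if "i \<in> {1..n}" for i
  proof -
    have "(\<integral>\<^sup>+X. ennreal \<bar>X i j - mean \<mu> j\<bar> \<partial>sample n)
        = (\<integral>\<^sup>+X. ennreal \<bar>X j - mean \<mu> j\<bar> \<partial>distr (sample n) \<mu> (\<lambda>X. X i))"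
      using assms that by (subst nn_integral_distr) auto
    also have "distr (sample n) \<mu> (\<lambda>X. X i) = \<mu>"
      using distr_PiM_component[of "{1..n}" "\<lambda>_. \<mu>" i] prob that by simp
    finally show ?thesis
      using abs_deviation_coordinate_le[OF assms(1)] by simp
  qed
  have "ennreal \<bar>deviation n X j\<bar> \<le> ennreal (1 / real n) * (\<Sum>i=1..n. ennreal \<bar>X i j - mean \<mu> j\<bar>)" for X
  proof -
    have "real n * \<bar>deviation n X j\<bar> \<le> (\<Sum>i=1..n. \<bar>X i j - mean \<mu> j\<bar>)"
      using sum_abs[of "\<lambda>i. X i j - mean \<mu> j" "{1..n}"] deviation_eq[OF assms(2), of X j]
      by (metis abs_mult abs_of_nat)
    then have "\<bar>deviation n X j\<bar> \<le> (1 / real n) * (\<Sum>i=1..n. \<bar>X i j - mean \<mu> j\<bar>)"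
      using assms by (simp add: field_simps)
    then show ?thesis
      by (simp add: ennreal_leI ennreal_mult[symmetric] sum_nonneg)
  qed
  then have "(\<integral>\<^sup>+X. ennreal \<bar>deviation n X j\<bar> \<partial>sample n)
      \<le> (\<integral>\<^sup>+X. ennreal (1 / real n) * (\<Sum>i=1..n. ennreal \<bar>X i j - mean \<mu> j\<bar>) \<partial>sample n)"
    by (intro nn_integral_mono)
  also have "\<dots> = ennreal (1 / real n) * (\<Sum>i=1..n. \<integral>\<^sup>+X. ennreal \<bar>X i j - mean \<mu> j\<bar> \<partial>sample n)"
    using assms
    by (simp add: nn_integral_cmult nn_integral_sum borel_measurable_sum del: sum_ennreal)
  also have "\<dots> \<le> ennreal (1 / real n) * (\<Sum>i=1..n. ennreal (2 * tilde_mean \<mu> j))"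
    by (intro mult_left_mono sum_mono *) auto
  also have "\<dots> = ennreal (2 * tilde_mean \<mu> j)"
    using assms tilde_mean_bounds[OF assms(1)]
    by (simp add: ennreal_mult[symmetric] ennreal_of_nat_eq_real_of_nat)
  finally show ?thesis .
qed

text \<open>The exponential Markov inequality with the optimal parameter \<open>l = ln (1 + e / q)\<close>; the Bennett
  function \<open>(1 + u) ln (1 + u) - u\<close> that it produces is at least \<open>u ln (1 + u) / 2\<close>.\<close>

lemma excess_deviation_le:
  assumes "1 \<le> j" "1 \<le> n" "0 < e" "0 < tilde_mean \<mu> j"
  defines "l \<equiv> ln (1 + e / tilde_mean \<mu> j)"
  shows "(\<integral>\<^sup>+X. ennreal (max 0 (\<bar>deviation n X j\<bar> - e)) \<partial>sample n)
    \<le> ennreal (2 / (real n * l) * exp (- (real n * e * l / 2)))"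
proof -
  define q where "q = tilde_mean \<mu> j"
  define k where "k = exp (- (l * real n * e)) / (l * real n)"
  define b where "b = exp (real n * (q * (exp l - 1 - l)))"
  have q: "0 < q" using assms by (simp add: q_def)
  have l: "0 < l" unfolding l_def using assms(3,4) by (intro ln_gt_zero) simp
  have k: "0 \<le> k" using l by (simp add: k_def)
  have m: "(\<lambda>X. ennreal (exp (c * (real n * deviation n X j)))) \<in> borel_measurable (sample n)" for c
    using assms(1) by measurable
  have "(\<integral>\<^sup>+X. ennreal (max 0 (\<bar>deviation n X j\<bar> - e)) \<partial>sample n)
      \<le> (\<integral>\<^sup>+X. (ennreal (exp (l * (real n * deviation n X j)))
          + ennreal (exp (- l * (real n * deviation n X j)))) * ennreal k \<partial>sample n)"
  proof (intro nn_integral_mono)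
    fix X
    have "max 0 (\<bar>deviation n X j\<bar> - e)
        \<le> (exp (l * (real n * deviation n X j)) + exp (- l * (real n * deviation n X j))) * k"
      using abs_excess_le_exp[of "l * real n" "deviation n X j" e] l assms
      by (simp add: k_def mult.assoc)
    then show "ennreal (max 0 (\<bar>deviation n X j\<bar> - e))
        \<le> (ennreal (exp (l * (real n * deviation n X j)))
          + ennreal (exp (- l * (real n * deviation n X j)))) * ennreal k"
      using k by (simp add: ennreal_leI ennreal_mult[symmetric] ennreal_plus[symmetric] del: ennreal_plus)
  qed
  also have "\<dots> = ((\<integral>\<^sup>+X. ennreal (exp (l * (real n * deviation n X j))) \<partial>sample n)
      + (\<integral>\<^sup>+X. ennreal (exp (- l * (real n * deviation n X j))) \<partial>sample n)) * ennreal k"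
    by (subst nn_integral_multc) (use m in \<open>auto simp only: nn_integral_add intro!: borel_measurable_add\<close>)
  also have "\<dots> \<le> (ennreal b + ennreal b) * ennreal k"
    using mgf_deviation_le[OF assms(1,2), of l] mgf_deviation_le[OF assms(1,2), of "- l"] l
    by (intro mult_right_mono add_mono) (auto simp: b_def q_def)
  also have "\<dots> = ennreal (2 * b * k)"
    using k by (simp add: b_def ennreal_mult[symmetric] ennreal_plus[symmetric] del: ennreal_plus)
  also have "\<dots> \<le> ennreal (2 / (real n * l) * exp (- (real n * e * l / 2)))"
  proof (intro ennreal_leI)
    have "exp l = 1 + e / q"
      using assms q by (simp add: l_def q_def add_pos_pos)
    then have b: "q * (exp l - 1 - l) = e - q * l"
      using q by (simp add: field_simps)
    \<comment> \<open>Divided by \<open>n\<close>, the total exponent is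
      \<open>e - q * l - l * e\<close>. That it is at most \<open>- e * l / 2\<close> amounts to
      \<open>2 * e \<le> l * (2 * q + e)\<close>, which is this inequality with denominators
      cleared.\<close>
    have "2 * (e / q) / (2 + e / q) \<le> l"
      using ln_one_plus_ge[of "e / q"] q assms by (simp add: l_def q_def)
    then have "2 * e \<le> l * (2 * q + e)"
      using q assms(3) by (simp add: field_simps)
    then have "real n * (2 * e) \<le> real n * (l * (2 * q + e))"
      by (intro mult_left_mono) auto
    then have "real n * (e - q * l) - l * real n * e \<le> - (real n * e * l / 2)"
      by (simp add: algebra_simps)
    then have "exp (real n * (e - q * l)) * exp (- (l * real n * e)) \<le> exp (- (real n * e * l / 2))"
      by (simp add: exp_add[symmetric])
    then have "2 / (real n * l) * (exp (real n * (e - q * l)) * exp (- (l * real n * e)))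
        \<le> 2 / (real n * l) * exp (- (real n * e * l / 2))"
      using l by (intro mult_left_mono) auto
    then show "2 * b * k \<le> 2 / (real n * l) * exp (- (real n * e * l / 2))"
      unfolding b_def k_def b by (simp add: mult_ac)
  qed
  finally show ?thesis .
qed

section \<open>From single coordinates to the supremum\<close>

text \<open>Positions are distinct and at least \<open>1\<close>, so the weights in
  \<open>excess\<close> add up to at most \<open>1\<close>. Bounding the nonnegative integral
  suffices, which spares a proof that the supremum is integrable.\<close>

lemma Delta_le:
  assumes "1 \<le> n" "0 \<le> e" "0 \<le> K" and lim: "tilde_mean \<mu> \<longlonglongrightarrow> 0"
    and excess: "\<And>j. 1 \<le> j \<Longrightarrow> 0 < tilde_mean \<mu> j \<Longrightarrow>
      (\<integral>\<^sup>+X. ennreal (max 0 (\<bar>deviation n X j\<bar> - e)) \<partial>sample n)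
        \<le> ennreal (K * (1 / (real (position (tilde_mean \<mu>) j) + 1)\<^sup>2))"
  shows "Delta n \<mu> \<le> e + K"
  unfolding Delta_def
proof (rule integral_real_bounded)
  interpret P: prob_space "sample n" by (rule prob_space_sample)
  \<comment> \<open>Coordinates start at \<open>1\<close> and the series at \<open>0\<close>, hence
    \<open>Suc i\<close>. Where \<open>tilde_mean\<close> is zero the expected deviation is zero
    too, so no weight is spent there.\<close>
  define b where "b i = (if 0 < tilde_mean \<mu> (Suc i)
    then K * (1 / (real (position (tilde_mean \<mu>) (Suc i)) + 1)\<^sup>2) else 0)" for i
  let ?x = "\<lambda>X i. ennreal (max 0 (\<bar>deviation n X (Suc i)\<bar> - e))"
  show "0 \<le> e + K" using assms by simp
  \<comment> \<open>This covers every \<open>X\<close>, even where the deviations are unbounded: an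
    infinite series leaves nothing to show, and a finite one dominates each of its terms.\<close>
  have sup_le: "ennreal (SUP j\<in>{1..}. \<bar>deviation n X j\<bar>) \<le> ennreal e + (\<Sum>i. ?x X i)" for X
  proof (cases "\<Sum>i. ?x X i")
    case (real r)
    have "(SUP j\<in>{1..}. \<bar>deviation n X j\<bar>) \<le> e + r"
    proof (rule cSUP_least)
      fix j :: nat
      assume "j \<in> {1..}"
      then obtain i where i: "j = Suc i" by (cases j) auto
      have "?x X i \<le> (\<Sum>i. ?x X i)"
        using sum_le_suminf[of "?x X" "{i}"] by simp
      then have "max 0 (\<bar>deviation n X j\<bar> - e) \<le> r"
        using real i by simp
      then show "\<bar>deviation n X j\<bar> \<le> e + r" by simp
    qed simp
    then show ?thesis
      using real assms(2) by (simp add: ennreal_plus[symmetric] ennreal_leI del: ennreal_plus)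
  qed simp
  have excess': "(\<integral>\<^sup>+X. ?x X i \<partial>sample n) \<le> ennreal (b i)" for i
  proof (cases "0 < tilde_mean \<mu> (Suc i)")
    case True
    then show ?thesis using excess[of "Suc i"] by (simp add: b_def)
  next
    case False
    have "(\<integral>\<^sup>+X. ?x X i \<partial>sample n) \<le> (\<integral>\<^sup>+X. ennreal \<bar>deviation n X (Suc i)\<bar> \<partial>sample n)"
      using assms(2) by (intro nn_integral_mono ennreal_leI) auto
    also have "\<dots> \<le> ennreal (2 * tilde_mean \<mu> (Suc i))"
      using assms(1) by (intro abs_deviation_le) auto
    finally show ?thesis
      using False by (simp add: b_def ennreal_neg)
  qed
  have b_sum: "(\<Sum>i. ennreal (b i)) \<le> ennreal K"
    unfolding suminf_eq_SUP
  proof (rule SUP_least)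
    fix k
    define I where "I = {i \<in> {..<k}. 0 < tilde_mean \<mu> (Suc i)}"
    let ?r = "\<lambda>i. position (tilde_mean \<mu>) (Suc i)"
    have "inj_on ?r I"
      using inj_on_position[OF lim] by (auto simp: inj_on_def I_def)
    then have "(\<Sum>i\<in>I. 1 / (real (?r i) + 1)\<^sup>2) = (\<Sum>m\<in>?r ` I. 1 / (real m + 1)\<^sup>2)"
      by (simp add: sum.reindex)
    also have "\<dots> \<le> 1"
      using position_pos[OF lim]
      by (intro sum_inverse_squares_le_1) (fastforce simp: I_def)+
    finally have "K * (\<Sum>i\<in>I. 1 / (real (?r i) + 1)\<^sup>2) \<le> K"
      using assms(3) by (simp add: mult_left_le)
    moreover have "(\<Sum>i<k. b i) = K * (\<Sum>i\<in>I. 1 / (real (?r i) + 1)\<^sup>2)"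
      unfolding sum_distrib_left I_def b_def by (rule sum.inter_filter[symmetric]) simp
    moreover have "0 \<le> b i" for i
      using assms(3) by (simp add: b_def)
    ultimately show "(\<Sum>i<k. ennreal (b i)) \<le> ennreal K"
      by (simp add: ennreal_leI)
  qed
  have "(\<integral>\<^sup>+X. ennreal (SUP j\<in>{1..}. \<bar>deviation n X j\<bar>) \<partial>sample n)
      \<le> (\<integral>\<^sup>+X. ennreal e + (\<Sum>i. ?x X i) \<partial>sample n)"
    by (intro nn_integral_mono sup_le)
  also have "\<dots> = ennreal e + (\<Sum>i. \<integral>\<^sup>+X. ?x X i \<partial>sample n)"
  proof -
    have m: "(\<lambda>X. ?x X i) \<in> borel_measurable (sample n)" for i
      using deviation_measurable[of "Suc i" n] by measurable
    then have "(\<integral>\<^sup>+X. (\<Sum>i. ?x X i) \<partial>sample n) = (\<Sum>i. \<integral>\<^sup>+X. ?x X i \<partial>sample n)"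
      by (rule nn_integral_suminf)
    moreover have "(\<integral>\<^sup>+X. ennreal e \<partial>sample n) = ennreal e"
      using P.emeasure_space_1 by (simp del: One_nat_def)
    ultimately show ?thesis
      using m by (subst nn_integral_add) (simp_all del: One_nat_def add: borel_measurable_suminf_order)
  qed
  also have "\<dots> \<le> ennreal e + ennreal K"
    using suminf_le[OF excess' summableI summableI] b_sum by (intro add_left_mono) (rule order_trans)
  also have "\<dots> = ennreal (e + K)"
    using assms by simp
  finally show "(\<integral>\<^sup>+X. ennreal (SUP j\<in>{1..}. \<bar>deviation n X j\<bar>) \<partial>sample n) \<le> ennreal (e + K)" .
qed

end

section \<open>Numerical estimates for one entry of the rearrangement\<close>

text \<open>For an entry \<open>q\<close> at position \<open>m\<close> this is used with
  \<open>l = ln (m + 1)\<close>, so that \<open>exp (- 2 * l)\<close> is the weight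
  \<open>1 / (m + 1)^2\<close>; \<open>s\<close> and \<open>t\<close> are the values of
  \<open>S\<close> and \<open>T\<close>. It suffices to bound the prefactor by \<open>e\<close> and
  to make the exponent \<open>N * e * L / 2\<close> at least \<open>2 * l\<close>.\<close>

lemma excess_bound_le:
  fixes q s t N l e L :: real
  assumes q: "0 < q" and N: "exp 3 \<le> N" and l: "ln 2 \<le> l"
    and s: "q * l \<le> s" and t: "l \<le> t * ln (1 / q)" "1 \<le> 4 * t * ln N"
  defines "e \<equiv> 12 * (sqrt (s / N) + t * ln N / N)" and "L \<equiv> ln (1 + e / q)"
  shows "2 / (N * L) * exp (- (N * e * L / 2)) \<le> e * exp (- 2 * l)"
proof -
  have N0: "0 < N" using N exp_gt_zero[of 3] by linarith
  then have lnN: "3 \<le> ln N" using N by (simp add: ln_ge_iff)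
  have l0: "2 / 3 \<le> l" using l ln2_ge_two_thirds by linarith
  then have s0: "0 < s" using q s mult_pos_pos[of q l] by linarith
  have t0: "0 < t"
    using t(2) lnN by (smt (verit) mult_nonneg_nonpos2 mult_nonneg_nonneg)
  have Ne: "N * e = 12 * N * sqrt (s / N) + 12 * (t * ln N)"
    using N0 by (simp add: e_def algebra_simps)
  have Ne_ge: "12 * (t * ln N) \<le> N * e"
    using N0 s0 by (simp add: Ne)
  \<comment> \<open>Here the lower bound on \<open>t\<close> keeps \<open>e\<close> above
    \<open>1 / N\<close>.\<close>
  then have Ne3: "3 \<le> N * e" using t(2) by linarith
  then have e0: "0 < e" using N0 by (smt (verit) mult_nonneg_nonpos)
  have L0: "0 < L" unfolding L_def using q e0 by (intro ln_gt_zero) simp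
  have "2 / (N * L) \<le> e \<and> 2 * l \<le> N * e * L / 2"
  proof (cases "q < e")
    case True
    have "ln 2 \<le> L"
      unfolding L_def using True q by (intro ln_mono) auto
    then have L: "2 / 3 \<le> L" using ln2_ge_two_thirds by linarith
    have "3 * L \<ge> 2" using L by simp
    then have "2 \<le> N * e * L"
      using mult_right_mono[OF Ne3, of L] L0 by linarith
    then have 1: "2 / (N * L) \<le> e"
      using N0 L0 by (simp add: field_simps)
    \<comment> \<open>If \<open>q\<close> is at least \<open>N powr (- 2)\<close>, the constant
      bound on \<open>L\<close> is enough. Otherwise \<open>e / q\<close> is at least
      \<open>1 / (N * q)\<close>, which exceeds the square root of \<open>1 / q\<close>, so
      \<open>L\<close> is at least half of \<open>ln (1 / q)\<close>.\<close>
    have "ln (1 / q) \<le> 3 * ln N * L"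
    proof (cases "ln (1 / q) \<le> 2 * ln N")
      case True
      have "3 * ln N * (2 / 3) \<le> 3 * ln N * L"
        using L lnN by (intro mult_left_mono) auto
      then show ?thesis using True by simp
    next
      case False
      have "1 / N \<le> e" using Ne3 N0 by (simp add: field_simps)
      then have "ln (1 / N) \<le> ln e" using N0 by (intro ln_mono) auto
      moreover have "ln (e / q) \<le> L"
        unfolding L_def using q e0 by (intro ln_mono) auto
      ultimately have "ln (1 / q) / 2 \<le> L"
        using False q e0 N0 by (simp add: ln_div)
      moreover have "1 * L \<le> ln N * L"
        using lnN L0 by (intro mult_right_mono) auto
      ultimately show ?thesis using L0 unfolding mult.assoc by linarith
    qed
    then have "t * ln (1 / q) \<le> t * (3 * ln N * L)"
      using t0 by (intro mult_left_mono) auto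
    \<comment> \<open>The factor \<open>12\<close> in \<open>e\<close> is what this case needs to
      reach \<open>l \<le> N * e * L / 4\<close>.\<close>
    also have "\<dots> = 12 * (t * ln N) * L / 4"
      by simp
    also have "\<dots> \<le> N * e * L / 4"
      using mult_right_mono[OF Ne_ge, of L] L0 by simp
    finally show ?thesis using 1 t(1) by simp
  next
    case False
    \<comment> \<open>Now \<open>e / q\<close> is at most \<open>1\<close>, so \<open>L\<close> is
      at least a constant multiple of \<open>e / q\<close>.\<close>
    have "2 * e / (3 * q) \<le> 2 * (e / q) / (2 + e / q)"
      using False q e0 by (simp add: field_simps)
    also have "\<dots> \<le> L"
      unfolding L_def using q e0 by (intro ln_one_plus_ge) simp
    finally have L: "2 * e \<le> 3 * (q * L)"
      using q by (simp add: field_simps)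
    have "12 * sqrt (s / N) \<le> e"
    proof -
      have "0 \<le> t * ln N / N"
        by (intro divide_nonneg_pos mult_nonneg_nonneg) (use t0 lnN N0 in linarith)+
      then show ?thesis unfolding e_def by (intro mult_left_mono add_increasing2) auto
    qed
    then have "(12 * sqrt (s / N))\<^sup>2 \<le> e\<^sup>2"
      using s0 N0 by (intro power_mono) auto
    then have "144 * (s / N) \<le> e\<^sup>2"
      using s0 N0 by (simp add: power_mult_distrib)
    then have es: "144 * s \<le> N * e * e"
      using N0 by (simp add: field_simps power2_eq_square)
    have "N * e * (2 * e) \<le> N * e * (3 * (q * L))"
      using N0 e0 by (intro mult_left_mono L) auto
    \<comment> \<open>\<open>96\<close> is two thirds of \<open>144\<close>. Since
      \<open>q * l \<le> s\<close>, the factor \<open>q\<close> cancels next, leaving far more than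
      the required \<open>4 * l\<close>.\<close>
    then have *: "96 * s \<le> q * (N * e * L)"
      using es by (simp add: mult_ac)
    have "q * (96 * l) \<le> q * (N * e * L)"
      using * s by simp
    then have 1: "96 * l \<le> N * e * L"
      using q by (simp only: mult_le_cancel_left_pos)
    then have "2 \<le> N * e * L" using l0 by linarith
    then have "2 / (N * L) \<le> e"
      using N0 L0 by (simp add: field_simps)
    then show ?thesis using 1 l0 by linarith
  qed
  then show ?thesis
    using e0 by (intro mult_mono) auto
qed

text \<open>By \<open>lt\<close>, \<open>q\<close> is at most \<open>exp (- l / t)\<close>. For
  small \<open>t\<close> this exponent covers both the summable weight and a factor of order
  \<open>t / N\<close>.\<close>

lemma mean_bound_le:
  fixes q t N l :: real
  assumes q: "0 < q" and N: "exp 3 \<le> N" and l: "ln 2 \<le> l" and t: "0 < t"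
    and lt: "l \<le> t * ln (1 / q)" and small: "4 * t * ln N < 1"
  shows "2 * q \<le> 32 * t / N * exp (- 2 * l)"
proof -
  have N0: "0 < N" using N exp_gt_zero[of 3] by linarith
  then have lnN: "3 \<le> ln N" using N by (simp add: ln_ge_iff)
  \<comment> \<open>With \<open>1 / t = 4 * y\<close>, the hypothesis \<open>lt\<close> becomes
    \<open>q \<le> exp (- (l * (4 * y)))\<close>.\<close>
  define y where "y = 1 / (4 * t)"
  have y: "ln N \<le> y" using small t by (simp add: y_def field_simps)
  have "q = exp (- ln (1 / q))" using q by (simp add: ln_div)
  \<comment> \<open>After this, \<open>exp (- 2 * l)\<close> is split off and the rest of the
    exponent is estimated at the least value \<open>l = ln 2\<close>, at the cost of the factor
    \<open>4 = exp (2 * ln 2)\<close>.\<close>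
  also have "\<dots> \<le> exp (- (l * (4 * y)))"
    using lt t by (simp add: y_def field_simps)
  also have "\<dots> \<le> exp (- 2 * l + (2 * ln 2 + (- y + - y)))"
  proof -
    have "ln 2 * (4 * y - 2) \<le> l * (4 * y - 2)"
      using l y lnN by (intro mult_right_mono) auto
    moreover have "2 / 3 * (4 * y) \<le> ln 2 * (4 * y)"
      using ln2_ge_two_thirds y lnN by (intro mult_right_mono) auto
    moreover have "2 * y \<le> 2 / 3 * (4 * y)"
      using y lnN by simp
    ultimately have "2 * y + ln 2 * (4 * y - 2) \<le> ln 2 * (4 * y) + l * (4 * y - 2)"
      by linarith
    then show ?thesis
      by (simp add: algebra_simps)
  qed
  also have "\<dots> = exp (- 2 * l) * (4 * (exp (- y) * exp (- y)))"
  proof -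
    have "exp (2 * ln 2) = (4 :: real)"
      using exp_of_nat_mult[of 2 "ln 2 :: real"] by simp
    then show ?thesis by (simp only: exp_add)
  qed
  \<comment> \<open>One factor \<open>exp (- y)\<close> yields \<open>1 / N\<close>, the other
    \<open>4 * t = 1 / y\<close>.\<close>
  also have "\<dots> \<le> exp (- 2 * l) * (4 * (1 / N * (4 * t)))"
  proof (intro mult_left_mono mult_mono)
    show "exp (- y) \<le> 1 / N"
    proof -
      have "N \<le> exp y" using y N0 by (metis exp_le_cancel_iff exp_ln)
      then show ?thesis using N0 by (simp add: exp_minus field_simps)
    qed
    have "y \<le> exp y" using exp_ge_add_one_self[of y] by linarith
    then show "exp (- y) \<le> 4 * t"
      using t by (simp add: exp_minus y_def field_simps)
  qed (use N0 in auto)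
  finally have "2 * q \<le> 2 * (exp (- 2 * l) * (4 * (1 / N * (4 * t))))" by linarith
  then show ?thesis by (simp add: mult_ac)
qed

section \<open>The bound on the expected supremum\<close>

theorem theorem3:
  "\<exists>c::real. c > 0 \<and>
     (\<forall>(\<mu> :: (nat \<Rightarrow> real) measure) (n :: nat).
        prob_space \<mu> \<longrightarrow> sets \<mu> = sets binary_sequences \<longrightarrow>
        T_measure \<mu> < \<infinity> \<longrightarrow> real n \<ge> exp 3 \<longrightarrow>
        ereal (Delta n \<mu>) \<le>
          ereal c * (ereal_sqrt (S_measure \<mu> / ereal (real n))
                     + T_measure \<mu> * ereal (ln (real n)) / ereal (real n)))"
proof (intro exI[of _ 32] conjI allI impI)
  fix \<mu> :: "(nat \<Rightarrow> real) measure" and n :: nat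
  assume "prob_space \<mu>" "sets \<mu> = sets binary_sequences"
    and T_fin: "T_measure \<mu> < \<infinity>" and n: "real n \<ge> exp 3"
  then interpret sampling \<mu> by (simp add: sampling_def)
  define N where "N = real n"
  have N: "exp 3 \<le> N" using n by (simp add: N_def)
  have N0: "0 < N" using N exp_gt_zero[of 3] by linarith
  then have n1: "1 \<le> n" by (simp add: N_def)
  have lnN: "3 \<le> ln N" using N N0 by (simp add: ln_ge_iff)
  let ?q = "tilde_mean \<mu>" and ?r = "position (tilde_mean \<mu>)"
  have lim: "?q \<longlonglongrightarrow> 0"
    using T_fin by (auto simp: T_measure_def split: if_splits)
  have T: "T_measure \<mu> = T_seq (rearrangement ?q)" and S: "S_measure \<mu> = S_seq (rearrangement ?q)"
    using lim by (simp_all add: T_measure_def S_measure_def)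
  have T_ge: "ereal (if rearrangement ?q j = 0 then 0
      else ln (real j + 1) / ln (1 / rearrangement ?q j)) \<le> T_measure \<mu>" if "1 \<le> j" for j
    unfolding T T_seq_def using that by (intro SUP_upper) simp
  have S_ge: "ereal (rearrangement ?q j * ln (real j + 1)) \<le> S_measure \<mu>" if "1 \<le> j" for j
    unfolding S S_seq_def using that by (intro SUP_upper) simp
  \<comment> \<open>The terms at \<open>1\<close> show that both suprema are nonnegative; for
    \<open>T\<close> this uses that the largest entry is at most \<open>1 / 2\<close>.\<close>
  have "is_nth_largest ?q 1 (rearrangement ?q 1)"
    by (rule is_nth_largest_rearrangement[OF tilde_mean_bounds(1) lim]) auto
  then have r1: "0 \<le> rearrangement ?q 1" "rearrangement ?q 1 \<le> 1 / 2"
    using tilde_mean_bounds by (auto simp: is_nth_largest_def)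
  have "0 \<le> ereal (if rearrangement ?q 1 = 0 then 0 else ln (real 1 + 1) / ln (1 / rearrangement ?q 1))"
    using r1 by (auto intro!: divide_nonneg_nonneg ln_ge_zero simp: field_simps)
  then have T_pos: "0 \<le> T_measure \<mu>"
    by (rule order_trans[OF _ T_ge]) simp
  have "0 \<le> ereal (rearrangement ?q 1 * ln (real 1 + 1))"
    using r1 by simp
  then have S_pos: "0 \<le> S_measure \<mu>"
    by (rule order_trans[OF _ S_ge]) simp
  obtain t where t: "T_measure \<mu> = ereal t" "0 \<le> t"
    using T_fin T_pos by (cases "T_measure \<mu>") auto
  show "ereal (Delta n \<mu>) \<le> ereal 32 * (ereal_sqrt (S_measure \<mu> / ereal (real n))
      + T_measure \<mu> * ereal (ln (real n)) / ereal (real n))"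
  proof (cases "S_measure \<mu>")
    case PInf
    then show ?thesis
      using N0 t by (simp add: N_def ereal_sqrt_def)
  next
    case MInf
    then show ?thesis using S_pos by simp
  next
    case (real s)
    then have s: "0 \<le> s" using S_pos by simp
    define v where "v = sqrt (s / N)"
    define w where "w = t * ln N / N"
    define e where "e = 12 * (v + w)"
    have v0: "0 \<le> v"
      using s N0 by (simp add: v_def)
    have w0: "0 \<le> w"
      unfolding w_def by (intro divide_nonneg_pos mult_nonneg_nonneg) (use t(2) N0 lnN in linarith)+
    have e0: "0 \<le> e"
      using v0 w0 by (simp add: e_def)
    \<comment> \<open>\<open>S\<close> and \<open>T\<close> are evaluated at the position of
      \<open>j\<close>, where the rearrangement takes the value \<open>?q j\<close>. As
      \<open>?q j\<close> is at most \<open>1 / 2\<close>, \<open>ln (1 / ?q j)\<close> is positive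
      and the quotient in \<open>T\<close> can be cleared.\<close>
    have at_position: "ln 2 \<le> ln (real (?r j) + 1)" "?q j * ln (real (?r j) + 1) \<le> s"
      "ln (real (?r j) + 1) \<le> t * ln (1 / ?q j)" "exp (- 2 * ln (real (?r j) + 1)) = 1 / (real (?r j) + 1)\<^sup>2"
      if j: "1 \<le> j" "0 < ?q j" for j
    proof -
      have r: "1 \<le> ?r j" using position_pos[OF lim j] by simp
      then show "ln 2 \<le> ln (real (?r j) + 1)" by (intro ln_mono) auto
      show "?q j * ln (real (?r j) + 1) \<le> s"
        using S_ge[OF r] real rearrangement_position[OF lim j] by simp
      have "0 < ln (1 / ?q j)"
        using j tilde_mean_bounds(2)[OF j(1)] by (intro ln_gt_zero) (simp add: field_simps)
      then show "ln (real (?r j) + 1) \<le> t * ln (1 / ?q j)"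
        using T_ge[OF r] t j rearrangement_position[OF lim j] by (simp add: field_simps)
      have "exp (2 * ln (real (?r j) + 1)) = (real (?r j) + 1)\<^sup>2"
        using exp_of_nat_mult[of 2 "ln (real (?r j) + 1)"] by (simp add: add_pos_nonneg)
      then show "exp (- 2 * ln (real (?r j) + 1)) = 1 / (real (?r j) + 1)\<^sup>2"
        by (simp add: exp_minus divide_inverse)
    qed
    \<comment> \<open>The first case needs the constant \<open>24\<close>, from
      \<open>e + e\<close>; the second needs \<open>32\<close>.\<close>
    have "Delta n \<mu> \<le> 32 * (v + w)"
    proof (cases "1 \<le> 4 * t * ln N")
      case True
      have "t \<noteq> 0" using True by auto
      then have "w \<noteq> 0"
        using N0 lnN by (auto simp: w_def)
      then have "0 < w"
        using w0 by simp
      then have e: "0 < e"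
        using v0 by (simp add: e_def)
      have "Delta n \<mu> \<le> e + e"
      proof (rule Delta_le[OF n1 e0 e0 lim])
        fix j :: nat
        assume j: "1 \<le> j" "0 < ?q j"
        show "(\<integral>\<^sup>+X. ennreal (max 0 (\<bar>deviation n X j\<bar> - e)) \<partial>sample n)
            \<le> ennreal (e * (1 / (real (?r j) + 1)\<^sup>2))"
          using excess_deviation_le[OF j(1) n1 e j(2)]
            ennreal_leI[OF excess_bound_le[OF j(2) N at_position(1-3)[OF j] True]]
          unfolding at_position(4)[OF j] v_def[symmetric] w_def[symmetric] e_def[symmetric] N_def[symmetric] by (rule order_trans)
      qed
      then show ?thesis
        using v0 w0 by (simp add: e_def)
    next
      case False
      \<comment> \<open>With threshold \<open>0\<close> the excess is the whole absolute
        deviation.\<close>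
      have "Delta n \<mu> \<le> 0 + 32 * t / N"
      proof (rule Delta_le[OF n1 order_refl _ lim])
        show "0 \<le> 32 * t / N" using t N0 by simp
        fix j :: nat
        assume j: "1 \<le> j" "0 < ?q j"
        \<comment> \<open>A positive entry forces \<open>T\<close> to be positive.\<close>
        have "t \<noteq> 0" using at_position(1,3)[OF j] ln2_ge_two_thirds by auto
        then have "2 * ?q j \<le> 32 * t / N * (1 / (real (?r j) + 1)\<^sup>2)"
          using mean_bound_le[OF j(2) N at_position(1)[OF j] _ at_position(3)[OF j]] t False
          unfolding at_position(4)[OF j] by simp
        then show "(\<integral>\<^sup>+X. ennreal (max 0 (\<bar>deviation n X j\<bar> - 0)) \<partial>sample n)
            \<le> ennreal (32 * t / N * (1 / (real (?r j) + 1)\<^sup>2))"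
          using order_trans[OF abs_deviation_le[OF j(1) n1] ennreal_leI] by simp
      qed
      also have "\<dots> \<le> 32 * (w)"
        using mult_left_mono[of 1 "ln N" t] t N0 lnN by (simp add: w_def divide_right_mono)
      also have "\<dots> \<le> 32 * (v + w)"
        using v0 by simp
      finally show ?thesis .
    qed
    then show ?thesis
      using real t N0 by (simp add: v_def w_def N_def ereal_sqrt_def)
  qed
qed simp

end
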